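(* In the theory $\mathsf{ZF}$ (Zermelo–Fraenkel set theory without the Axiom of Choice), the following two statements are equivalent: (1) the principle of Dependent Choice; (2) for every nonempty semi-separative partial order $\mathbb P$ in which every linearly ordered subset is finite, and for every family $\mathcal D$ of dense subsets of $\mathbb P$ (with no restriction on $\mathcal D$), there exists a $\mathcal D$-generic filter $G\subseteq\mathbb P$.
   Context: The principle of Dependent Choice is the statement that for every nonempty set $X$ equipped with a binary relation $R$ satisfying $(\forall x\in X)(\exists y\in X)(x\ R\ y)$, there exists a sequence $\langle x_n\mid n<\omega\rangle$ of elements of $X$ such that $x_n\ R\ x_{n+1}$ for all $n<\omega$. Let $\mathbb P$ be a partially ordered set with order $\leq$; $p$ extends $q$ if $p\leq q$. Two elements $p,q\in\mathbb P$ are compatible if there exists $r\in\mathbb P$ with $r\leq p$ and $r\leq q$; otherwise they are incompatible. $\mathbb P$ is semi-separative if for every $p\in\mathbb P$, either $p$ is minimal or $p$ has two incompatible extensions in $\mathbb P$. A subset $D\subseteq\mathbb P$ is dense if for every $p\in\mathbb P$ there is $q\in D$ with $q\leq p$. A subset $G\subseteq\mathbb P$ is a filter if it is closed upwards ($p\in G$ and $p\leq q$ imply $q\in G$) and for all $p,q\in G$ there exists $r\in G$ with $r\leq p$ and $r\leq q$. A filter $G$ is $\mathcal D$-generic if $G\cap D\neq\varnothing$ for every $D\in\mathcal D$. *)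

theory Defs
  imports Main
begin

text \<open>
  Isabelle/HOL has a choice operator, so an equivalence between choice principles over ZF is
  stated here about arbitrary models of first-order ZF.  A structure for the language of set theory
  is a (nonempty) type \<open>'v\<close> with a binary relation \<open>\<in>\<^sub>M\<close>.  All set-theoretic notions below,
  including finiteness, \<open>\<omega>\<close> and functions, are interpreted inside the structure: every
  quantifier ranges over elements of \<open>'v\<close>, so that each notion is a first-order formula in
  \<open>\<in>\<^sub>M\<close> and \<open>=\<close>.  The Separation and Replacement schemas range over first-order formulas with
  parameters and not over arbitrary HOL predicates on \<open>'v\<close>; the latter would give second-order
  ZF, whose models satisfy Dependent Choice because the metatheory does.
\<close>

datatype fm =
    Member nat nat
  | Equal nat nat
  | Neg fm
  | Conj fm fm
  | Forall nat fm

locale set_structure =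
  fixes mem :: "'v \<Rightarrow> 'v \<Rightarrow> bool"  (infix "\<in>\<^sub>M" 50)
begin

primrec sat :: "(nat \<Rightarrow> 'v) \<Rightarrow> fm \<Rightarrow> bool" where
  "sat s (Member i j) \<longleftrightarrow> s i \<in>\<^sub>M s j"
| "sat s (Equal i j) \<longleftrightarrow> s i = s j"
| "sat s (Neg \<phi>) \<longleftrightarrow> \<not> sat s \<phi>"
| "sat s (Conj \<phi> \<psi>) \<longleftrightarrow> sat s \<phi> \<and> sat s \<psi>"
| "sat s (Forall i \<phi>) \<longleftrightarrow> (\<forall>x. sat (s(i := x)) \<phi>)"

definition subset_of :: "'v \<Rightarrow> 'v \<Rightarrow> bool"  (infix "\<subseteq>\<^sub>M" 50) where
  "A \<subseteq>\<^sub>M B \<longleftrightarrow> (\<forall>x. x \<in>\<^sub>M A \<longrightarrow> x \<in>\<^sub>M B)"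

definition nonempty :: "'v \<Rightarrow> bool" where
  "nonempty A \<longleftrightarrow> (\<exists>x. x \<in>\<^sub>M A)"

definition is_upair :: "'v \<Rightarrow> 'v \<Rightarrow> 'v \<Rightarrow> bool" where
  "is_upair x y u \<longleftrightarrow> (\<forall>z. z \<in>\<^sub>M u \<longleftrightarrow> z = x \<or> z = y)"

text \<open>Kuratowski: \<open>p = {{x}, {x, y}}\<close>.\<close>
definition is_pair :: "'v \<Rightarrow> 'v \<Rightarrow> 'v \<Rightarrow> bool" where
  "is_pair x y p \<longleftrightarrow> (\<exists>a b. is_upair x x a \<and> is_upair x y b \<and> is_upair a b p)"

text \<open>\<open>s = x \<union> {x}\<close>\<close>
definition is_succ :: "'v \<Rightarrow> 'v \<Rightarrow> bool" where
  "is_succ x s \<longleftrightarrow> (\<forall>z. z \<in>\<^sub>M s \<longleftrightarrow> z \<in>\<^sub>M x \<or> z = x)"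

definition is_inductive :: "'v \<Rightarrow> bool" where
  "is_inductive I \<longleftrightarrow>
     (\<exists>e. \<not> nonempty e \<and> e \<in>\<^sub>M I) \<and>
     (\<forall>x. x \<in>\<^sub>M I \<longrightarrow> (\<exists>s. is_succ x s \<and> s \<in>\<^sub>M I))"

definition is_omega :: "'v \<Rightarrow> bool" where
  "is_omega w \<longleftrightarrow> is_inductive w \<and> (\<forall>I. is_inductive I \<longrightarrow> w \<subseteq>\<^sub>M I)"

definition rel :: "'v \<Rightarrow> 'v \<Rightarrow> 'v \<Rightarrow> bool" where
  "rel R x y \<longleftrightarrow> (\<exists>p. is_pair x y p \<and> p \<in>\<^sub>M R)"

definition is_relation :: "'v \<Rightarrow> 'v \<Rightarrow> 'v \<Rightarrow> bool" where
  "is_relation R A B \<longleftrightarrow>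
     (\<forall>p. p \<in>\<^sub>M R \<longrightarrow> (\<exists>x y. x \<in>\<^sub>M A \<and> y \<in>\<^sub>M B \<and> is_pair x y p))"

definition is_function :: "'v \<Rightarrow> 'v \<Rightarrow> 'v \<Rightarrow> bool" where
  "is_function f A B \<longleftrightarrow>
     is_relation f A B \<and> (\<forall>x. x \<in>\<^sub>M A \<longrightarrow> (\<exists>!y. rel f x y))"

definition is_bijection :: "'v \<Rightarrow> 'v \<Rightarrow> 'v \<Rightarrow> bool" where
  "is_bijection f A B \<longleftrightarrow>
     is_function f A B \<and> (\<forall>y. y \<in>\<^sub>M B \<longrightarrow> (\<exists>!x. rel f x y))"

text \<open>Finiteness in the sense of the structure: equipotent to some \<open>n \<in> \<omega>\<close>.\<close>
definition is_finite :: "'v \<Rightarrow> bool" where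
  "is_finite A \<longleftrightarrow> (\<exists>w n f. is_omega w \<and> n \<in>\<^sub>M w \<and> is_bijection f n A)"

definition dependent_choice :: bool where
  "dependent_choice \<longleftrightarrow>
     (\<forall>X R. nonempty X \<and> is_relation R X X \<and>
        (\<forall>x. x \<in>\<^sub>M X \<longrightarrow> (\<exists>y. y \<in>\<^sub>M X \<and> rel R x y)) \<longrightarrow>
        (\<exists>w f. is_omega w \<and> is_function f w X \<and>
           (\<forall>n m x y. n \<in>\<^sub>M w \<and> is_succ n m \<and> rel f n x \<and> rel f m y \<longrightarrow> rel R x y)))"

text \<open>In the following, \<open>P\<close> is the underlying set of a poset and \<open>L\<close> the set of pairs \<open>(p, q)\<close>
  with \<open>p \<le> q\<close>; the relation is reflexive, and \<open>p\<close> extends \<open>q\<close> if \<open>p \<le> q\<close>.\<close>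

definition is_partial_order :: "'v \<Rightarrow> 'v \<Rightarrow> bool" where
  "is_partial_order P L \<longleftrightarrow>
     is_relation L P P \<and>
     (\<forall>p. p \<in>\<^sub>M P \<longrightarrow> rel L p p) \<and>
     (\<forall>p q. rel L p q \<and> rel L q p \<longrightarrow> p = q) \<and>
     (\<forall>p q r. rel L p q \<and> rel L q r \<longrightarrow> rel L p r)"

definition compatible :: "'v \<Rightarrow> 'v \<Rightarrow> 'v \<Rightarrow> 'v \<Rightarrow> bool" where
  "compatible P L p q \<longleftrightarrow> (\<exists>r. r \<in>\<^sub>M P \<and> rel L r p \<and> rel L r q)"

definition is_minimal :: "'v \<Rightarrow> 'v \<Rightarrow> 'v \<Rightarrow> bool" where
  "is_minimal P L p \<longleftrightarrow> p \<in>\<^sub>M P \<and> (\<forall>q. q \<in>\<^sub>M P \<and> rel L q p \<longrightarrow> q = p)"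

definition semi_separative :: "'v \<Rightarrow> 'v \<Rightarrow> bool" where
  "semi_separative P L \<longleftrightarrow>
     (\<forall>p. p \<in>\<^sub>M P \<longrightarrow>
        is_minimal P L p \<or>
        (\<exists>q r. q \<in>\<^sub>M P \<and> r \<in>\<^sub>M P \<and> rel L q p \<and> rel L r p \<and> \<not> compatible P L q r))"

definition is_linear_subset :: "'v \<Rightarrow> 'v \<Rightarrow> 'v \<Rightarrow> bool" where
  "is_linear_subset P L C \<longleftrightarrow>
     C \<subseteq>\<^sub>M P \<and> (\<forall>p q. p \<in>\<^sub>M C \<and> q \<in>\<^sub>M C \<longrightarrow> rel L p q \<or> rel L q p)"

definition is_dense :: "'v \<Rightarrow> 'v \<Rightarrow> 'v \<Rightarrow> bool" where
  "is_dense P L D \<longleftrightarrow>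
     D \<subseteq>\<^sub>M P \<and> (\<forall>p. p \<in>\<^sub>M P \<longrightarrow> (\<exists>q. q \<in>\<^sub>M D \<and> rel L q p))"

definition is_filter :: "'v \<Rightarrow> 'v \<Rightarrow> 'v \<Rightarrow> bool" where
  "is_filter P L G \<longleftrightarrow>
     G \<subseteq>\<^sub>M P \<and>
     (\<forall>p q. p \<in>\<^sub>M G \<and> q \<in>\<^sub>M P \<and> rel L p q \<longrightarrow> q \<in>\<^sub>M G) \<and>
     (\<forall>p q. p \<in>\<^sub>M G \<and> q \<in>\<^sub>M G \<longrightarrow> (\<exists>r. r \<in>\<^sub>M G \<and> rel L r p \<and> rel L r q))"

definition is_generic :: "'v \<Rightarrow> 'v \<Rightarrow> bool" where
  "is_generic \<D> G \<longleftrightarrow> (\<forall>D. D \<in>\<^sub>M \<D> \<longrightarrow> (\<exists>p. p \<in>\<^sub>M G \<and> p \<in>\<^sub>M D))"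

definition generic_filter_principle :: bool where
  "generic_filter_principle \<longleftrightarrow>
     (\<forall>P L. nonempty P \<and> is_partial_order P L \<and> semi_separative P L \<and>
        (\<forall>C. is_linear_subset P L C \<longrightarrow> is_finite C) \<longrightarrow>
        (\<forall>\<D>. (\<forall>D. D \<in>\<^sub>M \<D> \<longrightarrow> is_dense P L D) \<longrightarrow>
           (\<exists>G. is_filter P L G \<and> is_generic \<D> G)))"

end

text \<open>In the schemas the assignment \<open>s\<close> supplies the parameters; variable \<open>0\<close> (and \<open>1\<close>) hold the
  arguments of the formula.  The set asserted to exist is not in the assignment, so no
  freshness side condition is needed.\<close>

locale ZF_model = set_structure mem
  for mem :: "'v \<Rightarrow> 'v \<Rightarrow> bool"  (infix "\<in>\<^sub>M" 50) +
  assumes extensionality: "\<forall>A B. (\<forall>x. x \<in>\<^sub>M A \<longleftrightarrow> x \<in>\<^sub>M B) \<longrightarrow> A = B"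
    and foundation: "\<forall>A. nonempty A \<longrightarrow> (\<exists>x. x \<in>\<^sub>M A \<and> \<not> (\<exists>y. y \<in>\<^sub>M x \<and> y \<in>\<^sub>M A))"
    and pairing: "\<forall>x y. \<exists>u. is_upair x y u"
    and union: "\<forall>A. \<exists>U. \<forall>x. x \<in>\<^sub>M U \<longleftrightarrow> (\<exists>B. x \<in>\<^sub>M B \<and> B \<in>\<^sub>M A)"
    and powerset: "\<forall>A. \<exists>Q. \<forall>B. B \<in>\<^sub>M Q \<longleftrightarrow> B \<subseteq>\<^sub>M A"
    and infinity: "\<exists>I. is_inductive I"
    and separation:
      "\<forall>\<phi> s A. \<exists>B. \<forall>x. x \<in>\<^sub>M B \<longleftrightarrow> x \<in>\<^sub>M A \<and> sat (s(0 := x)) \<phi>"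
    and replacement:
      "\<forall>\<phi> s. (\<forall>x y z. sat (s(0 := x, 1 := y)) \<phi> \<and> sat (s(0 := x, 1 := z)) \<phi> \<longrightarrow> y = z) \<longrightarrow>
         (\<forall>A. \<exists>B. \<forall>y. y \<in>\<^sub>M B \<longleftrightarrow> (\<exists>x. x \<in>\<^sub>M A \<and> sat (s(0 := x, 1 := y)) \<phi>))"

end

theory Submission imports Defs begin

text \<open>Dependent Choice yields a minimal element \<open>m\<close> of a poset whose chains are finite: otherwise it
  provides a strictly descending sequence, whose range is a finite nonempty chain without least
  element.  The cone above \<open>m\<close> is then a filter that meets every dense set.

  Conversely, order the finite \<open>R\<close>-paths in \<open>X\<close> by reverse inclusion.  This tree has no minimal
  elements.  If it is semi-separative and \<open>G\<close> is a filter, then the complement of \<open>G\<close> is dense, so no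
  filter is generic for all dense sets, and hence some chain is infinite.  If it is not
  semi-separative, the cone below some node is an infinite chain.  In both cases the union of the
  chain is an infinite \<open>R\<close>-path.

  Separation and induction on \<open>\<omega>\<close> are available for first-order predicates only, so each use comes
  with a proof that the predicate is definable.\<close>

section \<open>Definable predicates\<close>

primrec fv :: "fm \<Rightarrow> nat set" where
  "fv (Member i j) = {i, j}"
| "fv (Equal i j) = {i, j}"
| "fv (Neg \<phi>) = fv \<phi>"
| "fv (Conj \<phi> \<psi>) = fv \<phi> \<union> fv \<psi>"
| "fv (Forall i \<phi>) = fv \<phi> - {i}"

lemma finite_fv [simp]: "finite (fv \<phi>)"
  by (induction \<phi>) auto

definition interleave :: "(nat \<Rightarrow> 'v) \<Rightarrow> (nat \<Rightarrow> 'v) \<Rightarrow> nat \<Rightarrow> 'v" where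
  "interleave s e n = (if even n then s (n div 2) else e (n div 2))"

context set_structure
begin

section \<open>Renaming of variables in formulas\<close>

lemma sat_cong: "(\<And>i. i \<in> fv \<phi> \<Longrightarrow> s i = t i) \<Longrightarrow> sat s \<phi> \<longleftrightarrow> sat t \<phi>"
proof (induction \<phi> arbitrary: s t)
  case (Forall i \<phi>)
  have "sat (s(i := x)) \<phi> \<longleftrightarrow> sat (t(i := x)) \<phi>" for x
    by (rule Forall.IH) (use Forall.prems in auto)
  then show ?case by simp
next
  case (Conj \<phi> \<psi>)
  have "sat s \<phi> \<longleftrightarrow> sat t \<phi>" "sat s \<psi> \<longleftrightarrow> sat t \<psi>"
    by (rule Conj.IH; use Conj.prems in auto)+
  then show ?case by simp
next
  case (Neg \<phi>)
  have "sat s \<phi> \<longleftrightarrow> sat t \<phi>"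
    by (rule Neg.IH) (use Neg.prems in auto)
  then show ?case by simp
qed auto

text \<open>Renaming under a quantifier has to avoid capture: \<open>j\<close> replaces the bound
  variable \<open>i\<close>, so it must not be the image of another free variable of
  \<open>\<phi>\<close>.\<close>

lemma sat_Forall_fresh:
  assumes "j \<notin> \<rho> ` (fv \<phi> - {i})" "\<forall>s. sat s \<phi>' \<longleftrightarrow> sat (s \<circ> \<rho>(i := j)) \<phi>"
  shows "sat s (Forall j \<phi>') \<longleftrightarrow> (\<forall>x. sat ((s \<circ> \<rho>)(i := x)) \<phi>)"
proof -
  have "sat (s(j := x) \<circ> \<rho>(i := j)) \<phi> \<longleftrightarrow> sat ((s \<circ> \<rho>)(i := x)) \<phi>" for x
    by (rule sat_cong) (use assms(1) in auto)
  then show ?thesis by (simp add: assms(2))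
qed

lemma ex_fresh: "\<exists>j :: nat. j \<notin> \<rho> ` (fv \<phi> - {i})"
  by (rule ex_new_if_finite) (auto simp: infinite_UNIV_nat)

text \<open>The map \<open>\<rho>\<close> need not be injective. It is arbitrary in the induction
  because the quantifier case passes to \<open>\<rho>(i := j)\<close>.\<close>

lemma sat_rename: "\<exists>\<phi>'. \<forall>s. sat s \<phi>' \<longleftrightarrow> sat (s \<circ> \<rho>) \<phi>"
proof (induction \<phi> arbitrary: \<rho>)
  case (Member i j)
  show ?case by (rule exI[of _ "Member (\<rho> i) (\<rho> j)"]) simp
next
  case (Equal i j)
  show ?case by (rule exI[of _ "Equal (\<rho> i) (\<rho> j)"]) simp
next
  case (Neg \<phi>)
  then obtain \<phi>' where "\<forall>s. sat s \<phi>' \<longleftrightarrow> sat (s \<circ> \<rho>) \<phi>" by blast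
  then show ?case by (intro exI[of _ "Neg \<phi>'"]) (simp add: comp_def)
next
  case (Conj \<phi> \<psi>)
  then obtain \<phi>' \<psi>' where "\<forall>s. sat s \<phi>' \<longleftrightarrow> sat (s \<circ> \<rho>) \<phi>" "\<forall>s. sat s \<psi>' \<longleftrightarrow> sat (s \<circ> \<rho>) \<psi>"
    by blast
  then show ?case by (intro exI[of _ "Conj \<phi>' \<psi>'"]) (simp add: comp_def)
next
  case (Forall i \<phi>)
  obtain j where j: "j \<notin> \<rho> ` (fv \<phi> - {i})" using ex_fresh by blast
  obtain \<phi>' where "\<forall>s. sat s \<phi>' \<longleftrightarrow> sat (s \<circ> \<rho>(i := j)) \<phi>" using Forall by blast
  then have "\<forall>s. sat s (Forall j \<phi>') \<longleftrightarrow> sat (s \<circ> \<rho>) (Forall i \<phi>)"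
    using sat_Forall_fresh[OF j] by (simp del: sat.simps add: sat.simps(5)[of _ i])
  then show ?case by blast
qed

text \<open>Predicates on assignments that are first-order with parameters.  The even variables of the
  witnessing formula hold the arguments and the odd ones hold the parameters, so that a predicate
  may mention arbitrary fixed elements of the structure.\<close>
definition definable :: "((nat \<Rightarrow> 'v) \<Rightarrow> bool) \<Rightarrow> bool" where
  "definable P \<longleftrightarrow> (\<exists>\<phi> e. \<forall>s. P s \<longleftrightarrow> sat (interleave s e) \<phi>)"

text \<open>Variables are bound as de Bruijn indices: index \<open>0\<close> is the innermost one.\<close>
definition definable_term :: "((nat \<Rightarrow> 'v) \<Rightarrow> 'v) \<Rightarrow> bool" where
  "definable_term t \<longleftrightarrow> definable (\<lambda>s. s 0 = t (\<lambda>n. s (Suc n)))"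

section \<open>Closure of the definable predicates under logical operations and substitution\<close>

lemma definable_mem_var: "definable (\<lambda>s. s i \<in>\<^sub>M s j)"
  unfolding definable_def
  by (rule exI[of _ "Member (2 * i) (2 * j)"]) (simp add: interleave_def)

lemma definable_eq_var: "definable (\<lambda>s. s i = s j)"
  unfolding definable_def
  by (rule exI[of _ "Equal (2 * i) (2 * j)"]) (simp add: interleave_def)

lemma definable_eq_const: "definable (\<lambda>s. s i = c)"
  unfolding definable_def
  by (rule exI[of _ "Equal (2 * i) 1"], rule exI[of _ "\<lambda>_. c"]) (simp add: interleave_def)

lemma definable_not: "definable P \<Longrightarrow> definable (\<lambda>s. \<not> P s)"
  unfolding definable_def using sat.simps(3) by metis

text \<open>The two formulas come with different parameters \<open>d\<close> and \<open>e\<close>.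
  Interleaving these gives one parameter sequence for both, and the odd variables are renamed
  accordingly.\<close>

lemma definable_conj:
  assumes "definable P" "definable Q"
  shows "definable (\<lambda>s. P s \<and> Q s)"
proof -
  obtain \<phi> d \<psi> e where
    P: "\<forall>s. P s \<longleftrightarrow> sat (interleave s d) \<phi>" and Q: "\<forall>s. Q s \<longleftrightarrow> sat (interleave s e) \<psi>"
    using assms unfolding definable_def by blast
  \<comment> \<open>The parameter variable \<open>2k+1\<close> moves to \<open>4k+1\<close>, where
    \<open>?e\<close> supplies \<open>d k\<close>. Under \<open>?\<sigma>\<close> it moves to
    \<open>4k+3\<close>, where \<open>?e\<close> supplies \<open>e k\<close>.\<close>
  let ?\<rho> = "\<lambda>n. if even n then n else Suc (4 * (n div 2))"
  let ?\<sigma> = "\<lambda>n. if even n then n else Suc (2 * Suc (2 * (n div 2)))"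
  let ?e = "interleave d e"
  have "interleave s ?e (?\<rho> n) = interleave s d n" for s n
  proof (cases "even n")
    case False
    then obtain k where "n = Suc (2 * k)" by (metis oddE Suc_eq_plus1)
    moreover have "Suc (4 * k) div 2 = 2 * k" by presburger
    ultimately show ?thesis by (simp add: interleave_def)
  qed (simp add: interleave_def)
  then have d: "interleave s ?e \<circ> ?\<rho> = interleave s d" for s by auto
  have "interleave s ?e (?\<sigma> n) = interleave s e n" for s n
  proof (cases "even n")
    case False
    then obtain k where "n = Suc (2 * k)" by (metis oddE Suc_eq_plus1)
    moreover have "Suc (2 * Suc (2 * k)) div 2 = Suc (2 * k)" by presburger
    ultimately show ?thesis by (simp add: interleave_def del: mult_Suc_right)
  qed (simp add: interleave_def)
  then have e: "interleave s ?e \<circ> ?\<sigma> = interleave s e" for s by auto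
  obtain \<phi>' where "\<forall>s. sat s \<phi>' \<longleftrightarrow> sat (s \<circ> ?\<rho>) \<phi>"
    using sat_rename[of ?\<rho> \<phi>] by (elim exE)
  moreover obtain \<psi>' where "\<forall>s. sat s \<psi>' \<longleftrightarrow> sat (s \<circ> ?\<sigma>) \<psi>"
    using sat_rename[of ?\<sigma> \<psi>] by (elim exE)
  ultimately have "\<forall>s. (P s \<and> Q s) \<longleftrightarrow> sat (interleave s ?e) (Conj \<phi>' \<psi>')"
    by (simp only: P Q sat.simps d e) simp
  then show ?thesis unfolding definable_def by (intro exI)
qed

lemma definable_rename:
  assumes "definable P"
  shows "definable (\<lambda>s. P (\<lambda>n. s (\<rho> n)))"
proof -
  obtain \<phi> e where P: "\<forall>s. P s \<longleftrightarrow> sat (interleave s e) \<phi>"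
    using assms unfolding definable_def by blast
  let ?\<rho> = "\<lambda>n. if even n then 2 * \<rho> (n div 2) else n"
  have "interleave s e \<circ> ?\<rho> = interleave (\<lambda>n. s (\<rho> n)) e" for s
    by (auto simp: interleave_def)
  moreover obtain \<phi>' where "\<forall>s. sat s \<phi>' \<longleftrightarrow> sat (s \<circ> ?\<rho>) \<phi>"
    using sat_rename[of ?\<rho> \<phi>] by (elim exE)
  ultimately have "\<forall>s. P (\<lambda>n. s (\<rho> n)) \<longleftrightarrow> sat (interleave s e) \<phi>'" by (simp only: P) simp
  then show ?thesis unfolding definable_def by (intro exI)
qed

lemma definable_all:
  assumes "definable (\<lambda>s. P (\<lambda>n. s (Suc n)) (s 0))"
  shows "definable (\<lambda>s. \<forall>x. P s x)"
proof -
  obtain \<phi> e where \<phi>: "\<forall>s. P (\<lambda>n. s (Suc n)) (s 0) \<longleftrightarrow> sat (interleave s e) \<phi>"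
    using assms unfolding definable_def by blast
  have P: "P s x \<longleftrightarrow> sat (interleave (case_nat x s) e) \<phi>" for s x
    using \<phi>[rule_format, of "case_nat x s"] by simp
  \<comment> \<open>Adding the argument \<open>x\<close> in front shifts the other arguments by one,
    hence the even variables by two. The truncated value of \<open>n - 2\<close> at \<open>0\<close>
    is harmless because variable \<open>0\<close> is overwritten by \<open>x\<close>.\<close>
  let ?\<rho> = "\<lambda>n. if even n then n - 2 else n"
  have "((interleave s e \<circ> ?\<rho>)(0 := x)) n = interleave (case_nat x s) e n" for s x n
  proof (cases "even n \<and> n \<noteq> 0")
    case True
    then obtain k where "n = 2 * Suc k" by (metis dvdE mult_0_right not0_implies_Suc)
    then show ?thesis by (simp add: interleave_def)
  qed (auto simp: interleave_def)
  then have \<rho>: "(interleave s e \<circ> ?\<rho>)(0 := x) = interleave (case_nat x s) e" for s x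
    by (intro ext)
  obtain j where j: "j \<notin> ?\<rho> ` (fv \<phi> - {0})" using ex_fresh[of ?\<rho> \<phi> 0] by (elim exE)
  obtain \<phi>' where "\<forall>s. sat s \<phi>' \<longleftrightarrow> sat (s \<circ> ?\<rho>(0 := j)) \<phi>"
    using sat_rename[of "?\<rho>(0 := j)" \<phi>] by (elim exE)
  from sat_Forall_fresh[OF j this]
  have "\<forall>s. (\<forall>x. P s x) \<longleftrightarrow> sat (interleave s e) (Forall j \<phi>')"
    by (simp only: P \<rho>) simp
  then show ?thesis unfolding definable_def by (intro exI)
qed

lemma definable_imp: "definable P \<Longrightarrow> definable Q \<Longrightarrow> definable (\<lambda>s. P s \<longrightarrow> Q s)"
  using definable_not[OF definable_conj[OF _ definable_not]] by simp

lemma definable_disj: "definable P \<Longrightarrow> definable Q \<Longrightarrow> definable (\<lambda>s. P s \<or> Q s)"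
  using definable_imp[OF definable_not] by (simp add: disj_imp)

lemma definable_iff: "definable P \<Longrightarrow> definable Q \<Longrightarrow> definable (\<lambda>s. P s \<longleftrightarrow> Q s)"
  unfolding iff_conv_conj_imp by (intro definable_conj definable_imp)

lemma definable_ex:
  "definable (\<lambda>s. P (\<lambda>n. s (Suc n)) (s 0)) \<Longrightarrow> definable (\<lambda>s. \<exists>x. P s x)"
  using definable_not[OF definable_all[of "\<lambda>s x. \<not> P s x"]] definable_not by simp

text \<open>Terms are eliminated by a quantifier: \<open>P s (t s)\<close> says that some
  \<open>x\<close> equals \<open>t s\<close> and satisfies \<open>P s x\<close>.\<close>

lemma definable_subst:
  assumes "definable_term t" "definable (\<lambda>s. P (\<lambda>n. s (Suc n)) (s 0))"
  shows "definable (\<lambda>s. P s (t s))"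
  using definable_ex[of "\<lambda>s x. x = t s \<and> P s x"] definable_conj assms
  unfolding definable_term_def by simp

lemma definable_term_var: "definable_term (\<lambda>s. s i)"
  unfolding definable_term_def by (rule definable_eq_var)

lemma definable_term_const: "definable_term (\<lambda>s. c)"
  unfolding definable_term_def by (rule definable_eq_const)

lemma definable_term_rename:
  assumes "definable_term t"
  shows "definable_term (\<lambda>s. t (\<lambda>n. s (\<rho> n)))"
  using definable_rename[OF assms[unfolded definable_term_def], of "case_nat 0 (\<lambda>n. Suc (\<rho> n))"]
  unfolding definable_term_def by simp

lemma definable1:
  assumes "definable (\<lambda>s. P (s 0))" "definable_term t"
  shows "definable (\<lambda>s. P (t s))"
  by (rule definable_subst) (rule assms)+

text \<open>Reduces definability at arbitrary terms to definability at variables, by substituting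
  one term at a time.\<close>

lemma definable2:
  assumes "definable (\<lambda>s. P (s 0) (s (Suc 0)))" "definable_term t" "definable_term u"
  shows "definable (\<lambda>s. P (t s) (u s))"
proof (rule definable_subst[OF assms(2), of "\<lambda>s x. P x (u s)"],
    rule definable_subst[of _ "\<lambda>s. P (s 0)"])
  show "definable_term (\<lambda>s. u (\<lambda>n. s (Suc n)))" by (rule definable_term_rename) fact
  show "definable (\<lambda>s. P (s (Suc 0)) (s 0))"
    \<comment> \<open>The renaming swaps the first two variables.\<close>
    using definable_rename[OF assms(1), of "case_nat (Suc 0) (\<lambda>_. 0)"] by simp
qed

lemma definable3:
  assumes "definable (\<lambda>s. P (s 0) (s (Suc 0)) (s (Suc (Suc 0))))"
    "definable_term t" "definable_term u" "definable_term v"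
  shows "definable (\<lambda>s. P (t s) (u s) (v s))"
proof (rule definable_subst[OF assms(2), of "\<lambda>s x. P x (u s) (v s)"],
    rule definable_subst[of _ "\<lambda>s y. P (s 0) y (v (\<lambda>n. s (Suc n)))"],
    rule_tac[2] definable_subst[of _ "\<lambda>s. P (s (Suc 0)) (s 0)"])
  show "definable_term (\<lambda>s. u (\<lambda>n. s (Suc n)))" by (rule definable_term_rename) fact
  show "definable_term (\<lambda>s. v (\<lambda>n. s (Suc (Suc n))))"
    by (rule definable_term_rename[where \<rho> = "\<lambda>n. Suc (Suc n)"]) fact
  show "definable (\<lambda>s. P (s (Suc (Suc 0))) (s (Suc 0)) (s 0))"
    \<comment> \<open>The map \<open>2 - n\<close> reverses the order of the three
      variables.\<close>
    using definable_rename[OF assms(1), of "\<lambda>n. Suc (Suc 0) - n"] by simp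
qed

lemmas definable_mem = definable2[of "\<lambda>x y. x \<in>\<^sub>M y", OF definable_mem_var]
lemmas definable_eq = definable2[of "\<lambda>x y. x = y", OF definable_eq_var]

lemma definable_ex1:
  assumes "definable (\<lambda>s. P (\<lambda>n. s (Suc n)) (s 0))"
  shows "definable (\<lambda>s. \<exists>!x. P s x)"
  unfolding Ex1_def
  by (intro definable_ex definable_conj assms definable_all definable_imp definable_eq
      definable_term_var)
    \<comment> \<open>The uniqueness clause lies under a second quantifier, so the renaming keeps
      the inner variable \<open>0\<close> and skips variable \<open>1\<close>, the outer
      witness.\<close>
    (use definable_rename[OF assms, of "case_nat 0 (\<lambda>n. Suc (Suc n))"] in simp)

lemmas definable_intros =
  definable_not definable_conj definable_disj definable_imp definable_iff
  definable_all definable_ex definable_ex1 definable_mem definable_eq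
  definable_term_var definable_term_const

section \<open>Definability of the set-theoretic notions\<close>

lemma definable_upair:
  "definable_term t \<Longrightarrow> definable_term u \<Longrightarrow> definable_term v \<Longrightarrow>
    definable (\<lambda>s. is_upair (t s) (u s) (v s))"
  unfolding is_upair_def
  by (rule definable3[of "\<lambda>x y u. \<forall>z. z \<in>\<^sub>M u \<longleftrightarrow> z = x \<or> z = y"]) (intro definable_intros)

lemma definable_pair:
  "definable_term t \<Longrightarrow> definable_term u \<Longrightarrow> definable_term v \<Longrightarrow>
    definable (\<lambda>s. is_pair (t s) (u s) (v s))"
  by (rule definable3[of is_pair], unfold is_pair_def) (intro definable_intros definable_upair)

lemma definable_rel:
  "definable_term t \<Longrightarrow> definable_term u \<Longrightarrow> definable_term v \<Longrightarrow>
    definable (\<lambda>s. rel (t s) (u s) (v s))"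
  by (rule definable3[of rel], unfold rel_def) (intro definable_intros definable_pair)

lemma definable_succ:
  "definable_term t \<Longrightarrow> definable_term u \<Longrightarrow> definable (\<lambda>s. is_succ (t s) (u s))"
  by (rule definable2[of is_succ], unfold is_succ_def) (intro definable_intros)

lemma definable_subset:
  "definable_term t \<Longrightarrow> definable_term u \<Longrightarrow> definable (\<lambda>s. t s \<subseteq>\<^sub>M u s)"
  by (rule definable2[of subset_of], unfold subset_of_def) (intro definable_intros)

lemma definable_nonempty: "definable_term t \<Longrightarrow> definable (\<lambda>s. nonempty (t s))"
  by (rule definable1[of nonempty], unfold nonempty_def) (intro definable_intros)

lemma definable_inductive: "definable_term t \<Longrightarrow> definable (\<lambda>s. is_inductive (t s))"
  by (rule definable1[of is_inductive], unfold is_inductive_def)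
    (intro definable_intros definable_nonempty definable_succ)

lemma definable_omega: "definable_term t \<Longrightarrow> definable (\<lambda>s. is_omega (t s))"
  by (rule definable1[of is_omega], unfold is_omega_def)
    (intro definable_intros definable_inductive definable_subset)

lemma definable_relation:
  "definable_term t \<Longrightarrow> definable_term u \<Longrightarrow> definable_term v \<Longrightarrow>
    definable (\<lambda>s. is_relation (t s) (u s) (v s))"
  by (rule definable3[of is_relation], unfold is_relation_def)
    (intro definable_intros definable_pair)

lemma definable_function:
  "definable_term t \<Longrightarrow> definable_term u \<Longrightarrow> definable_term v \<Longrightarrow>
    definable (\<lambda>s. is_function (t s) (u s) (v s))"
  by (rule definable3[of is_function], unfold is_function_def)
    (intro definable_intros definable_relation definable_rel)

lemma definable_bijection:
  "definable_term t \<Longrightarrow> definable_term u \<Longrightarrow> definable_term v \<Longrightarrow>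
    definable (\<lambda>s. is_bijection (t s) (u s) (v s))"
  by (rule definable3[of is_bijection], unfold is_bijection_def)
    (intro definable_intros definable_function definable_rel)

lemma definable_finite: "definable_term t \<Longrightarrow> definable (\<lambda>s. is_finite (t s))"
  by (rule definable1[of is_finite], unfold is_finite_def)
    (intro definable_intros definable_omega definable_bijection)

lemma definable_linear_subset:
  "definable_term t \<Longrightarrow> definable_term u \<Longrightarrow> definable_term v \<Longrightarrow>
    definable (\<lambda>s. is_linear_subset (t s) (u s) (v s))"
  by (rule definable3[of is_linear_subset], unfold is_linear_subset_def)
    (intro definable_intros definable_rel definable_subset)

lemmas definable_set_intros =
  definable_intros definable_pair definable_rel definable_succ definable_subset definable_nonempty
  definable_inductive definable_function definable_finite definable_linear_subset

end

section \<open>Sets, functions and natural numbers in a model\<close>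

lemma interleave_upd_0: "(interleave s e)(0 := x) = interleave (s(0 := x)) e"
  by (auto simp: interleave_def fun_eq_iff elim!: evenE)

context ZF_model
begin

section \<open>Elementary set constructions\<close>

lemma set_eqI: "(\<And>x. x \<in>\<^sub>M A \<longleftrightarrow> x \<in>\<^sub>M B) \<Longrightarrow> A = B"
  using extensionality by blast

text \<open>Extensionality makes the set unique. Named sets such as \<open>upair\<close>,
  \<open>adjoin\<close> and \<open>emp\<close> get their membership rules from this.\<close>

lemma mem_The_iff:
  assumes "\<exists>A. \<forall>x. x \<in>\<^sub>M A \<longleftrightarrow> P x"
  shows "x \<in>\<^sub>M (THE A. \<forall>x. x \<in>\<^sub>M A \<longleftrightarrow> P x) \<longleftrightarrow> P x"
proof -
  have "\<exists>!A. \<forall>x. x \<in>\<^sub>M A \<longleftrightarrow> P x"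
    using assms by (auto intro: set_eqI)
  from theI'[OF this] show ?thesis by blast
qed

text \<open>The form in which the Separation schema is used: the argument occupies variable
  \<open>0\<close> and the parameters stay in the odd variables.\<close>

lemma separate:
  assumes "definable (\<lambda>s. P (s 0))"
  shows "\<exists>B. \<forall>x. x \<in>\<^sub>M B \<longleftrightarrow> x \<in>\<^sub>M A \<and> P x"
proof -
  obtain \<phi> e where \<phi>: "\<forall>s. P (s 0) \<longleftrightarrow> sat (interleave s e) \<phi>"
    using assms unfolding definable_def by blast
  have "P x \<longleftrightarrow> sat ((interleave (\<lambda>_. A) e)(0 := x)) \<phi>" for x
    using \<phi>[rule_format, of "(\<lambda>_. A)(0 := x)"] by (simp add: interleave_upd_0)
  then show ?thesis using separation by simp
qed

definition upair :: "'v \<Rightarrow> 'v \<Rightarrow> 'v" where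
  "upair x y = (THE u. \<forall>z. z \<in>\<^sub>M u \<longleftrightarrow> z = x \<or> z = y)"

lemma mem_upair [simp]: "z \<in>\<^sub>M upair x y \<longleftrightarrow> z = x \<or> z = y"
  unfolding upair_def using pairing[unfolded is_upair_def] by (intro mem_The_iff) blast

lemma is_upair_iff: "is_upair x y u \<longleftrightarrow> u = upair x y"
  using set_eqI[of u "upair x y"] by (auto simp: is_upair_def)

definition pair :: "'v \<Rightarrow> 'v \<Rightarrow> 'v" where
  "pair x y = upair (upair x x) (upair x y)"

lemma is_pair_iff: "is_pair x y p \<longleftrightarrow> p = pair x y"
  by (simp add: is_pair_def is_upair_iff pair_def)

lemma upair_eqD: "upair a b = upair c d \<Longrightarrow> a = c \<and> b = d \<or> a = d \<and> b = c"
  by (metis mem_upair)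

lemma pair_inject [simp]: "pair a b = pair c d \<longleftrightarrow> a = c \<and> b = d"
  unfolding pair_def by (auto dest!: upair_eqD)

lemma rel_iff: "rel R x y \<longleftrightarrow> pair x y \<in>\<^sub>M R"
  by (simp add: rel_def is_pair_iff)

text \<open>The set is the union of the unordered pair of \<open>A\<close> and the singleton of
  \<open>x\<close>.\<close>

lemma adjoin_ex: "\<exists>B. \<forall>z. z \<in>\<^sub>M B \<longleftrightarrow> z \<in>\<^sub>M A \<or> z = x"
  using union[rule_format, of "upair A (upair x x)"] by (metis mem_upair)

definition adjoin :: "'v \<Rightarrow> 'v \<Rightarrow> 'v" where
  "adjoin x A = (THE B. \<forall>z. z \<in>\<^sub>M B \<longleftrightarrow> z \<in>\<^sub>M A \<or> z = x)"

lemma mem_adjoin [simp]: "z \<in>\<^sub>M adjoin x A \<longleftrightarrow> z \<in>\<^sub>M A \<or> z = x"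
  unfolding adjoin_def using adjoin_ex by (rule mem_The_iff)

lemma eq_adjoin_iff: "B = adjoin x A \<longleftrightarrow> (\<forall>z. z \<in>\<^sub>M B \<longleftrightarrow> z \<in>\<^sub>M A \<or> z = x)"
  using set_eqI[of B "adjoin x A"] by auto

lemma definable_adjoin:
  assumes "definable_term t" "definable_term u"
  shows "definable_term (\<lambda>s. adjoin (t s) (u s))"
  unfolding definable_term_def
proof (rule definable3[of "\<lambda>B x A. B = adjoin x A"])
  show "definable (\<lambda>s. s 0 = adjoin (s (Suc 0)) (s (Suc (Suc 0))))"
    unfolding eq_adjoin_iff by (intro definable_set_intros)
qed (rule definable_term_var definable_term_rename[OF assms(1)] definable_term_rename[OF assms(2)])+

abbreviation suc :: "'v \<Rightarrow> 'v" where
  "suc n \<equiv> adjoin n n"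

lemma is_succ_iff: "is_succ n m \<longleftrightarrow> m = suc n"
  by (simp add: is_succ_def eq_adjoin_iff)

lemma emp_ex: "\<exists>e. \<forall>x. \<not> x \<in>\<^sub>M e"
  using infinity unfolding is_inductive_def nonempty_def by blast

definition emp :: 'v where
  "emp = (THE e. \<forall>x. x \<in>\<^sub>M e \<longleftrightarrow> False)"

lemma not_mem_emp [simp]: "\<not> x \<in>\<^sub>M emp"
  using mem_The_iff[of "\<lambda>_. False" x] emp_ex by (simp add: emp_def)

lemma not_nonempty_iff: "\<not> nonempty A \<longleftrightarrow> A = emp"
  unfolding nonempty_def using set_eqI[of A emp] by auto

section \<open>The natural numbers of the model\<close>

lemma is_inductive_iff:
  "is_inductive I \<longleftrightarrow> emp \<in>\<^sub>M I \<and> (\<forall>n. n \<in>\<^sub>M I \<longrightarrow> suc n \<in>\<^sub>M I)"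
  by (simp add: is_inductive_def not_nonempty_iff is_succ_iff)

text \<open>The members common to all inductive sets are separated from one inductive set
  \<open>I\<close>, which exists by Infinity.\<close>

lemma omega_ex: "\<exists>w. is_omega w"
proof -
  obtain I where I: "is_inductive I" using infinity by blast
  have "definable (\<lambda>s. \<forall>J. is_inductive J \<longrightarrow> s 0 \<in>\<^sub>M J)"
    by (intro definable_set_intros)
  from separate[OF this, of I] obtain w
    where w: "\<forall>x. x \<in>\<^sub>M w \<longleftrightarrow> x \<in>\<^sub>M I \<and> (\<forall>J. is_inductive J \<longrightarrow> x \<in>\<^sub>M J)" by blast
  then have "is_inductive w" using I by (simp add: is_inductive_iff)
  with w have "is_omega w" by (simp add: is_omega_def subset_of_def)
  then show ?thesis ..
qed

definition omega :: 'v  ("\<omega>\<^sub>M") where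
  "\<omega>\<^sub>M = (THE w. is_omega w)"

lemma is_omega_iff: "is_omega w \<longleftrightarrow> w = \<omega>\<^sub>M"
proof -
  have unique: "v = w" if "is_omega v" "is_omega w" for v w
  proof (rule set_eqI)
    have "v \<subseteq>\<^sub>M w" "w \<subseteq>\<^sub>M v" using that by (simp_all add: is_omega_def)
    then show "x \<in>\<^sub>M v \<longleftrightarrow> x \<in>\<^sub>M w" for x unfolding subset_of_def by blast
  qed
  obtain v where v: "is_omega v" using omega_ex ..
  have "\<omega>\<^sub>M = v" unfolding omega_def using v by (rule the_equality) (rule unique[OF _ v])
  then show ?thesis using v unique[OF _ v] by (metis (no_types))
qed

lemma emp_in_omega [simp]: "emp \<in>\<^sub>M \<omega>\<^sub>M"
  and suc_in_omega [simp]: "n \<in>\<^sub>M \<omega>\<^sub>M \<Longrightarrow> suc n \<in>\<^sub>M \<omega>\<^sub>M"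
  using is_omega_iff[of "\<omega>\<^sub>M"] by (auto simp: is_omega_def is_inductive_iff)

text \<open>The members of \<open>\<omega>\<^sub>M\<close> with property \<open>P\<close> form an
  inductive set. Definability is what makes them a set of the model.\<close>

lemma omega_induct:
  assumes "definable (\<lambda>s. P (s 0))"
    and "P emp" "\<And>n. n \<in>\<^sub>M \<omega>\<^sub>M \<Longrightarrow> P n \<Longrightarrow> P (suc n)" "n \<in>\<^sub>M \<omega>\<^sub>M"
  shows "P n"
proof -
  obtain I where I: "\<forall>x. x \<in>\<^sub>M I \<longleftrightarrow> x \<in>\<^sub>M \<omega>\<^sub>M \<and> P x"
    using separate[OF assms(1)] by blast
  then have "is_inductive I" using assms(2,3) by (simp add: is_inductive_iff)
  then have "\<omega>\<^sub>M \<subseteq>\<^sub>M I" using is_omega_iff[of "\<omega>\<^sub>M"] by (simp add: is_omega_def)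
  then show ?thesis using I assms(4) by (auto simp: subset_of_def)
qed

lemma omega_cases:
  assumes "n \<in>\<^sub>M \<omega>\<^sub>M"
  obtains "n = emp" | k where "k \<in>\<^sub>M \<omega>\<^sub>M" "n = suc k"
proof -
  have "n = emp \<or> (\<exists>k. k \<in>\<^sub>M \<omega>\<^sub>M \<and> n = suc k)"
    by (rule omega_induct[of "\<lambda>n. n = emp \<or> (\<exists>k. k \<in>\<^sub>M \<omega>\<^sub>M \<and> n = suc k)", OF _ _ _ assms])
      (intro definable_set_intros definable_adjoin | blast)+
  then show ?thesis using that by blast
qed

lemma omega_mem_omega:
  assumes "n \<in>\<^sub>M \<omega>\<^sub>M" "k \<in>\<^sub>M n"
  shows "k \<in>\<^sub>M \<omega>\<^sub>M"
proof -
  have "\<forall>k. k \<in>\<^sub>M n \<longrightarrow> k \<in>\<^sub>M \<omega>\<^sub>M"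
    by (rule omega_induct[of "\<lambda>n. \<forall>k. k \<in>\<^sub>M n \<longrightarrow> k \<in>\<^sub>M \<omega>\<^sub>M", OF _ _ _ assms(1)])
      (intro definable_set_intros, auto)
  then show ?thesis using assms(2) by blast
qed

lemma omega_mem_trans:
  assumes "n \<in>\<^sub>M \<omega>\<^sub>M" "k \<in>\<^sub>M n" "j \<in>\<^sub>M k"
  shows "j \<in>\<^sub>M n"
proof -
  have "\<forall>k j. k \<in>\<^sub>M n \<longrightarrow> j \<in>\<^sub>M k \<longrightarrow> j \<in>\<^sub>M n"
    by (rule omega_induct[of "\<lambda>n. \<forall>k j. k \<in>\<^sub>M n \<longrightarrow> j \<in>\<^sub>M k \<longrightarrow> j \<in>\<^sub>M n", OF _ _ _ assms(1)])
      (intro definable_set_intros, auto)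
  then show ?thesis using assms(2,3) by blast
qed

lemma mem_irrefl [simp]: "\<not> x \<in>\<^sub>M x"
  using foundation[rule_format, of "upair x x"] by (auto simp: nonempty_def)

lemma mem_asym: "x \<in>\<^sub>M y \<Longrightarrow> \<not> y \<in>\<^sub>M x"
  using foundation[rule_format, of "upair x y"] by (auto simp: nonempty_def)

text \<open>Two different sets with the same successor would be members of each other.\<close>

lemma suc_inject [simp]: "suc m = suc n \<longleftrightarrow> m = n"
  by (metis mem_adjoin mem_asym)

lemma emp_or_emp_mem:
  assumes "n \<in>\<^sub>M \<omega>\<^sub>M"
  shows "emp = n \<or> emp \<in>\<^sub>M n"
  by (rule omega_induct[of "\<lambda>n. emp = n \<or> emp \<in>\<^sub>M n", OF _ _ _ assms])
    (intro definable_set_intros, auto)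

lemma suc_eq_or_mem:
  assumes "n \<in>\<^sub>M \<omega>\<^sub>M" "k \<in>\<^sub>M n"
  shows "suc k = n \<or> suc k \<in>\<^sub>M n"
proof -
  have "\<forall>k. k \<in>\<^sub>M n \<longrightarrow> suc k = n \<or> suc k \<in>\<^sub>M n"
    by (rule omega_induct[of "\<lambda>n. \<forall>k. k \<in>\<^sub>M n \<longrightarrow> suc k = n \<or> suc k \<in>\<^sub>M n", OF _ _ _ assms(1)])
      (intro definable_set_intros definable_adjoin, auto)
  then show ?thesis using assms(2) by blast
qed

text \<open>Induction on \<open>m\<close> with \<open>n\<close> fixed; the two preceding lemmas
  provide the base case and the case \<open>m \<in>\<^sub>M n\<close> of the step.\<close>

lemma omega_trichotomy:
  assumes "m \<in>\<^sub>M \<omega>\<^sub>M" "n \<in>\<^sub>M \<omega>\<^sub>M"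
  shows "m \<in>\<^sub>M n \<or> m = n \<or> n \<in>\<^sub>M m"
proof (rule omega_induct[of "\<lambda>m. m \<in>\<^sub>M n \<or> m = n \<or> n \<in>\<^sub>M m", OF _ _ _ assms(1)])
  show "emp \<in>\<^sub>M n \<or> emp = n \<or> n \<in>\<^sub>M emp" using emp_or_emp_mem[OF assms(2)] by auto
next
  fix m assume "m \<in>\<^sub>M n \<or> m = n \<or> n \<in>\<^sub>M m"
  then show "suc m \<in>\<^sub>M n \<or> suc m = n \<or> n \<in>\<^sub>M suc m"
    using suc_eq_or_mem[OF assms(2)] by auto
qed (intro definable_set_intros)

section \<open>Relations and functions as sets\<close>

lemma relation_separate:
  assumes "definable (\<lambda>s. Q (s 0) (s (Suc 0)))"
  shows "\<exists>R. is_relation R A B \<and> (\<forall>x y. rel R x y \<longleftrightarrow> x \<in>\<^sub>M A \<and> y \<in>\<^sub>M B \<and> Q x y)"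
proof -
  obtain U where U: "\<forall>x. x \<in>\<^sub>M U \<longleftrightarrow> x \<in>\<^sub>M A \<or> x \<in>\<^sub>M B"
    using union[rule_format, of "upair A B"] by auto
  \<comment> \<open>With \<open>U\<close> the union of \<open>A\<close> and \<open>B\<close>, a
    Kuratowski pair of members of \<open>U\<close> is a set of subsets of \<open>U\<close>. The
    double power set \<open>W\<close> therefore contains all the pairs to be separated.\<close>
  obtain V where V: "\<forall>x. x \<in>\<^sub>M V \<longleftrightarrow> x \<subseteq>\<^sub>M U" using powerset by blast
  obtain W where W: "\<forall>x. x \<in>\<^sub>M W \<longleftrightarrow> x \<subseteq>\<^sub>M V" using powerset by blast
  have "definable (\<lambda>s. \<exists>x y. x \<in>\<^sub>M A \<and> y \<in>\<^sub>M B \<and> Q x y \<and> is_pair x y (s 0))"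
    by (intro definable_set_intros definable2[of Q, OF assms])
  from separate[OF this, of W] obtain R where R: "\<forall>p. p \<in>\<^sub>M R \<longleftrightarrow>
      p \<in>\<^sub>M W \<and> (\<exists>x y. x \<in>\<^sub>M A \<and> y \<in>\<^sub>M B \<and> Q x y \<and> is_pair x y p)" by blast
  have "pair x y \<in>\<^sub>M W" if "x \<in>\<^sub>M A" "y \<in>\<^sub>M B" for x y
    using that U V W by (auto simp: pair_def subset_of_def)
  then show ?thesis
    using R by (intro exI[of _ R]) (auto simp: is_relation_def rel_iff is_pair_iff)
qed

lemma relation_field: "is_relation R A B \<Longrightarrow> rel R x y \<Longrightarrow> x \<in>\<^sub>M A \<and> y \<in>\<^sub>M B"
  by (auto simp: is_relation_def rel_iff is_pair_iff)

text \<open>Uniqueness of values needs no restriction to \<open>A\<close>, because every first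
  component of a pair in \<open>f\<close> lies in \<open>A\<close>.\<close>

lemma is_function_iff:
  "is_function f A B \<longleftrightarrow> is_relation f A B \<and> (\<forall>x. x \<in>\<^sub>M A \<longrightarrow> (\<exists>y. rel f x y)) \<and>
    (\<forall>x y z. rel f x y \<longrightarrow> rel f x z \<longrightarrow> y = z)"
  unfolding is_function_def using relation_field by blast

lemma rel_adjoin [simp]: "rel (adjoin (pair a b) f) x y \<longleftrightarrow> rel f x y \<or> x = a \<and> y = b"
  by (auto simp: rel_iff)

lemma is_relation_adjoin:
  "is_relation f A B \<Longrightarrow> b \<in>\<^sub>M B' \<Longrightarrow> B \<subseteq>\<^sub>M B' \<Longrightarrow>
    is_relation (adjoin (pair a b) f) (adjoin a A) B'"
  unfolding is_relation_def is_pair_iff subset_of_def mem_adjoin by blast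

lemma is_function_adjoin:
  assumes "is_function f A B" "\<not> a \<in>\<^sub>M A" "b \<in>\<^sub>M B'" "B \<subseteq>\<^sub>M B'"
  shows "is_function (adjoin (pair a b) f) (adjoin a A) B'"
  unfolding is_function_iff
proof (intro conjI allI impI)
  show "is_relation (adjoin (pair a b) f) (adjoin a A) B'"
    using assms by (intro is_relation_adjoin[of f A B]) (simp_all add: is_function_iff)
  show "\<exists>y. rel (adjoin (pair a b) f) x y" if "x \<in>\<^sub>M adjoin a A" for x
    using that assms(1) unfolding is_function_iff mem_adjoin rel_adjoin by blast
  show "y = z" if "rel (adjoin (pair a b) f) x y" "rel (adjoin (pair a b) f) x z" for x y z
    using that assms(1,2) relation_field[of f A B] unfolding is_function_iff rel_adjoin by blast
qed

section \<open>Finite sets\<close>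

lemma is_finite_iff: "is_finite A \<longleftrightarrow> (\<exists>n f. n \<in>\<^sub>M \<omega>\<^sub>M \<and> is_bijection f n A)"
  by (auto simp: is_finite_def is_omega_iff)

lemma finite_emp: "is_finite emp"
proof -
  have "is_bijection emp emp emp"
    by (auto simp: is_bijection_def is_function_def is_relation_def)
  then show ?thesis using emp_in_omega unfolding is_finite_iff by blast
qed

text \<open>For a new \<open>x\<close>, a bijection from \<open>n\<close> is prolonged by the pair
  of \<open>n\<close> and \<open>x\<close>; this keeps it a function because \<open>n\<close> is not
  a member of itself.\<close>

lemma finite_adjoin:
  assumes "is_finite A"
  shows "is_finite (adjoin x A)"
proof (cases "x \<in>\<^sub>M A")
  case True
  then have "adjoin x A = A" by (intro set_eqI) auto
  with assms show ?thesis by simp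
next
  case False
  obtain n f where nf: "n \<in>\<^sub>M \<omega>\<^sub>M" "is_bijection f n A"
    using assms unfolding is_finite_iff by blast
  have "is_function (adjoin (pair n x) f) (suc n) (adjoin x A)"
    using nf(2) by (intro is_function_adjoin[of f n A]) (auto simp: is_bijection_def subset_of_def)
  moreover have "rel f k y \<Longrightarrow> k \<in>\<^sub>M n \<and> y \<in>\<^sub>M A" for k y
    using nf(2) relation_field by (auto simp: is_bijection_def is_function_def)
  then have "\<exists>!k. rel (adjoin (pair n x) f) k y" if "y \<in>\<^sub>M adjoin x A" for y
    using that False nf(2) unfolding is_bijection_def rel_adjoin mem_adjoin by metis
  ultimately have "is_bijection (adjoin (pair n x) f) (suc n) (adjoin x A)"
    by (simp add: is_bijection_def)
  then show ?thesis using suc_in_omega[OF nf(1)] unfolding is_finite_iff by blast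
qed

text \<open>With \<open>C\<close> enumerated by \<open>f\<close>, induction on \<open>n\<close>
  finds the least value of \<open>f\<close> at indices below \<open>n\<close>.\<close>

lemma finite_linear_has_least:
  assumes L: "is_partial_order P L" and C: "is_linear_subset P L C" "is_finite C" "nonempty C"
  shows "\<exists>m. m \<in>\<^sub>M C \<and> (\<forall>x. x \<in>\<^sub>M C \<longrightarrow> rel L m x)"
proof -
  obtain N f where N: "N \<in>\<^sub>M \<omega>\<^sub>M" and f: "is_bijection f N C"
    using C(2) unfolding is_finite_iff by blast
  have f_range: "rel f k x \<Longrightarrow> x \<in>\<^sub>M C" for k x
    using f relation_field by (auto simp: is_bijection_def is_function_def)
  have f_fun: "rel f k x \<Longrightarrow> rel f k y \<Longrightarrow> x = y" for k x y
    using f by (auto simp: is_bijection_def is_function_iff)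
  have lin: "rel L x y \<or> rel L y x" if "x \<in>\<^sub>M C" "y \<in>\<^sub>M C" for x y
    using C(1) that by (simp add: is_linear_subset_def)
  have trans: "rel L x y \<Longrightarrow> rel L y z \<Longrightarrow> rel L x z" for x y z
    using L unfolding is_partial_order_def by blast
  let ?Q = "\<lambda>n. (\<exists>k x. k \<in>\<^sub>M n \<and> rel f k x) \<longrightarrow>
    (\<exists>k m. k \<in>\<^sub>M n \<and> rel f k m \<and> (\<forall>j x. j \<in>\<^sub>M n \<longrightarrow> rel f j x \<longrightarrow> rel L m x))"
  have "?Q N"
  proof (rule omega_induct[of ?Q, OF _ _ _ N])
    fix n assume IH: "?Q n"
    show "?Q (suc n)"
    \<comment> \<open>The induction runs through all of \<open>\<omega>\<^sub>M\<close>, also past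
      the domain \<open>N\<close>. Where \<open>f\<close> has no value at \<open>n\<close>, the
      claim does not change.\<close>
    proof (cases "\<exists>x. rel f n x")
      case False
      then have "k \<in>\<^sub>M suc n \<and> rel f k x \<longleftrightarrow> k \<in>\<^sub>M n \<and> rel f k x" for k x by auto
      then show ?thesis using IH by metis
    next
      case True
      then obtain x where x: "rel f n x" by blast
      show ?thesis
      proof (cases "\<exists>k y. k \<in>\<^sub>M n \<and> rel f k y")
        case False
        then have "\<forall>j y. j \<in>\<^sub>M suc n \<longrightarrow> rel f j y \<longrightarrow> rel L x y"
          using x lin f_range f_fun by (metis mem_adjoin)
        then show ?thesis using x by (metis mem_adjoin)
      next
        case True
        then obtain k m where m: "k \<in>\<^sub>M n" "rel f k m"
          "\<forall>j y. j \<in>\<^sub>M n \<longrightarrow> rel f j y \<longrightarrow> rel L m y" using IH by blast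
        have "rel L m x \<or> rel L x m" using lin f_range m(2) x by blast
        then show ?thesis
        proof
          assume "rel L m x"
          then have "\<forall>j y. j \<in>\<^sub>M suc n \<longrightarrow> rel f j y \<longrightarrow> rel L m y"
            using m(3) x f_fun by (metis mem_adjoin)
          then show ?thesis using m by (metis mem_adjoin)
        next
          assume "rel L x m"
          then have "\<forall>j y. j \<in>\<^sub>M suc n \<longrightarrow> rel f j y \<longrightarrow> rel L x y"
            using m(3) x f_fun trans lin f_range by (metis mem_adjoin)
          then show ?thesis using x by (metis mem_adjoin)
        qed
      qed
    qed
  qed (intro definable_set_intros, auto)
  moreover have surj: "\<exists>k. k \<in>\<^sub>M N \<and> rel f k x" if "x \<in>\<^sub>M C" for x
    using f that relation_field[of f N C] unfolding is_bijection_def is_function_def by blast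
  ultimately show ?thesis using C(3) f_range unfolding nonempty_def by metis
qed

section \<open>Inclusion between functions\<close>

lemma relation_subsetI:
  assumes "is_relation f A B" "\<And>x y. rel f x y \<Longrightarrow> rel g x y"
  shows "f \<subseteq>\<^sub>M g"
  using assms by (fastforce simp: subset_of_def is_relation_def rel_iff is_pair_iff)

lemma rel_mono: "f \<subseteq>\<^sub>M g \<Longrightarrow> rel f x y \<Longrightarrow> rel g x y"
  by (simp add: subset_of_def rel_iff)

lemma subset_antisym: "A \<subseteq>\<^sub>M B \<Longrightarrow> B \<subseteq>\<^sub>M A \<Longrightarrow> A = B"
  by (rule set_eqI) (auto simp: subset_of_def)

text \<open>Both \<open>f\<close> and \<open>g\<close> are restrictions of \<open>h\<close>, so
  their values agree and inclusion is decided by the domains.\<close>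

lemma restrictions_subset:
  assumes "is_function f A X" "is_function g B X" "is_function h D X"
    and "f \<subseteq>\<^sub>M h" "g \<subseteq>\<^sub>M h" "A \<subseteq>\<^sub>M B"
  shows "f \<subseteq>\<^sub>M g"
proof (rule relation_subsetI)
  show "is_relation f A X" using assms(1) by (simp add: is_function_def)
  fix x y assume xy: "rel f x y"
  with assms(1,6) have "x \<in>\<^sub>M B"
    using relation_field unfolding is_function_iff subset_of_def by blast
  with assms(2) obtain z where z: "rel g x z" unfolding is_function_iff by blast
  with xy assms(4,5) have "rel h x y" "rel h x z" by (auto intro: rel_mono)
  with assms(3) have "y = z" unfolding is_function_iff by blast
  with z show "rel g x y" by simp
qed

lemma is_linear_subset_mono: "is_linear_subset P L C \<Longrightarrow> D \<subseteq>\<^sub>M C \<Longrightarrow> is_linear_subset P L D"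
  unfolding is_linear_subset_def subset_of_def by blast

section \<open>Minimal elements and generic filters\<close>

lemma dependent_choice_imp_minimal:
  assumes dc: dependent_choice and L: "is_partial_order P L" and P: "nonempty P"
    and fin: "\<forall>C. is_linear_subset P L C \<longrightarrow> is_finite C"
  shows "\<exists>m. is_minimal P L m"
proof (rule ccontr)
  assume "\<nexists>m. is_minimal P L m"
  then have no_min: "\<exists>q. q \<in>\<^sub>M P \<and> rel L q p \<and> q \<noteq> p" if "p \<in>\<^sub>M P" for p
    using that unfolding is_minimal_def by blast
  have L_refl: "p \<in>\<^sub>M P \<Longrightarrow> rel L p p"
    and L_antisym: "rel L p q \<Longrightarrow> rel L q p \<Longrightarrow> p = q"
    and L_trans: "rel L p q \<Longrightarrow> rel L q r \<Longrightarrow> rel L p r" for p q r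
    using L unfolding is_partial_order_def by blast+
  have "definable (\<lambda>s. rel L (s (Suc 0)) (s 0) \<and> s (Suc 0) \<noteq> s 0)"
    by (intro definable_set_intros)
  \<comment> \<open>\<open>R\<close> leads from an element to its proper extensions, so a sequence
    along \<open>R\<close> descends strictly.\<close>
  from relation_separate[OF this, of P P] obtain R where R: "is_relation R P P"
    "\<forall>x y. rel R x y \<longleftrightarrow> x \<in>\<^sub>M P \<and> y \<in>\<^sub>M P \<and> rel L y x \<and> y \<noteq> x" by blast
  have "\<forall>x. x \<in>\<^sub>M P \<longrightarrow> (\<exists>y. y \<in>\<^sub>M P \<and> rel R x y)" using no_min R(2) by blast
  then obtain f where f: "is_function f \<omega>\<^sub>M P"
    and step: "\<And>n x y. n \<in>\<^sub>M \<omega>\<^sub>M \<Longrightarrow> rel f n x \<Longrightarrow> rel f (suc n) y \<Longrightarrow> rel R x y"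
    using dc[unfolded dependent_choice_def is_omega_iff is_succ_iff, rule_format, of P R] P R(1)
    by blast
  have f_total: "n \<in>\<^sub>M \<omega>\<^sub>M \<Longrightarrow> \<exists>x. rel f n x"
    and f_unique: "rel f n x \<Longrightarrow> rel f n y \<Longrightarrow> x = y"
    and f_field: "rel f n x \<Longrightarrow> n \<in>\<^sub>M \<omega>\<^sub>M \<and> x \<in>\<^sub>M P" for n x y
    using f relation_field[of f] unfolding is_function_iff by blast+
  \<comment> \<open>Dependent Choice compares consecutive terms only; transitivity of the order
    carries this over to any two terms.\<close>
  have descending: "\<forall>k x y. k \<in>\<^sub>M n \<longrightarrow> rel f k x \<longrightarrow> rel f n y \<longrightarrow> rel L y x"
    if "n \<in>\<^sub>M \<omega>\<^sub>M" for n
  proof (rule omega_induct[of "\<lambda>n. \<forall>k x y. k \<in>\<^sub>M n \<longrightarrow> rel f k x \<longrightarrow> rel f n y \<longrightarrow> rel L y x",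
        OF _ _ _ that])
    fix n assume n: "n \<in>\<^sub>M \<omega>\<^sub>M"
      and IH: "\<forall>k x y. k \<in>\<^sub>M n \<longrightarrow> rel f k x \<longrightarrow> rel f n y \<longrightarrow> rel L y x"
    show "\<forall>k x y. k \<in>\<^sub>M suc n \<longrightarrow> rel f k x \<longrightarrow> rel f (suc n) y \<longrightarrow> rel L y x"
    proof (intro allI impI)
      fix k x y assume k: "k \<in>\<^sub>M suc n" and x: "rel f k x" and y: "rel f (suc n) y"
      obtain z where z: "rel f n z" using f_total[OF n] by blast
      then have yz: "rel L y z" using step[OF n z y] R(2) by blast
      show "rel L y x"
      proof (cases "k = n")
        case True
        then show ?thesis using yz f_unique x z by blast
      next
        case False
        then have "rel L z x" using k IH x z by simp
        then show ?thesis using yz L_trans by blast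
      qed
    qed
  qed (intro definable_set_intros, simp)
  have "definable (\<lambda>s. \<exists>n. rel f n (s 0))" by (intro definable_set_intros)
  from separate[OF this, of P] obtain C
    where C: "\<forall>x. x \<in>\<^sub>M C \<longleftrightarrow> x \<in>\<^sub>M P \<and> (\<exists>n. rel f n x)" by blast
  have lin: "is_linear_subset P L C"
    unfolding is_linear_subset_def
  proof (intro conjI allI impI)
    show "C \<subseteq>\<^sub>M P" using C by (simp add: subset_of_def)
    fix p q assume "p \<in>\<^sub>M C \<and> q \<in>\<^sub>M C"
    then obtain m n where mn: "rel f m p" "rel f n q" using C by blast
    then have "m \<in>\<^sub>M n \<or> m = n \<or> n \<in>\<^sub>M m" using omega_trichotomy f_field by blast
    then show "rel L p q \<or> rel L q p"
      using descending mn f_field f_unique L_refl by metis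
  qed
  obtain x where "rel f emp x" using f_total[OF emp_in_omega] by blast
  then have "nonempty C" using C f_field unfolding nonempty_def by blast
  then obtain m where m: "m \<in>\<^sub>M C" "\<forall>x. x \<in>\<^sub>M C \<longrightarrow> rel L m x"
    using finite_linear_has_least[OF L lin] fin lin by blast
  then obtain n where n: "rel f n m" using C by blast
  \<comment> \<open>The least member \<open>m\<close> of the range is the term at \<open>n\<close>,
    but the next term \<open>y\<close> lies strictly below it.\<close>
  then have "n \<in>\<^sub>M \<omega>\<^sub>M" using f_field by blast
  moreover from this obtain y where y: "rel f (suc n) y" using f_total suc_in_omega by blast
  ultimately have "rel R m y" using step n by blast
  then have "rel L y m" "y \<noteq> m" using R(2) by blast+
  moreover have "rel L m y" using m(2) C y f_field by blast
  ultimately show False using L_antisym by blast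
qed

lemma dependent_choice_imp_generic_filter_principle:
  assumes dependent_choice
  shows generic_filter_principle
  unfolding generic_filter_principle_def
proof (intro allI impI)
  fix P L \<D>
  assume *: "nonempty P \<and> is_partial_order P L \<and> semi_separative P L \<and>
    (\<forall>C. is_linear_subset P L C \<longrightarrow> is_finite C)"
    and \<D>: "\<forall>D. D \<in>\<^sub>M \<D> \<longrightarrow> is_dense P L D"
  then obtain m where m: "is_minimal P L m"
    using dependent_choice_imp_minimal[OF assms] by blast
  have mP: "m \<in>\<^sub>M P" and m_min: "\<And>q. q \<in>\<^sub>M P \<Longrightarrow> rel L q m \<Longrightarrow> q = m"
    using m unfolding is_minimal_def by blast+
  have mm: "rel L m m" and trans: "\<And>p q r. rel L p q \<Longrightarrow> rel L q r \<Longrightarrow> rel L p r"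
    using * mP unfolding is_partial_order_def by blast+
  have "definable (\<lambda>s. rel L m (s 0))" by (intro definable_set_intros)
  \<comment> \<open>\<open>G\<close> is the cone above \<open>m\<close>; any two of its members have
    the common lower bound \<open>m\<close> in \<open>G\<close>.\<close>
  from separate[OF this, of P] obtain G
    where G: "\<forall>q. q \<in>\<^sub>M G \<longleftrightarrow> q \<in>\<^sub>M P \<and> rel L m q" by blast
  have "is_filter P L G"
    unfolding is_filter_def subset_of_def using G mP mm trans by blast
  moreover have "is_generic \<D> G"
    unfolding is_generic_def
  proof (intro allI impI)
    fix D assume "D \<in>\<^sub>M \<D>"
    then have "is_dense P L D" using \<D> by blast
    \<comment> \<open>Density gives a member of \<open>D\<close> below \<open>m\<close>, and
      minimality forces it to be \<open>m\<close> itself.\<close>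
    then obtain q where "q \<in>\<^sub>M D" "rel L q m" "q \<in>\<^sub>M P"
      using mP unfolding is_dense_def subset_of_def by blast
    then show "\<exists>p. p \<in>\<^sub>M G \<and> p \<in>\<^sub>M D" using m_min G mP mm by blast
  qed
  ultimately show "\<exists>G. is_filter P L G \<and> is_generic \<D> G" by blast
qed

text \<open>Without minimal elements every \<open>p\<close> has two incompatible extensions, and a
  filter contains at most one of them. Its complement is then dense, so no filter meets all dense
  sets.\<close>

lemma generic_filter_principle_imp_minimal:
  assumes gfp: generic_filter_principle and L: "is_partial_order P L" and P: "nonempty P"
    and semi: "semi_separative P L"
    and fin: "\<forall>C. is_linear_subset P L C \<longrightarrow> is_finite C"
  shows "\<exists>m. is_minimal P L m"
proof (rule ccontr)
  assume no_min: "\<nexists>m. is_minimal P L m"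
  obtain Q where Q: "\<forall>D. D \<in>\<^sub>M Q \<longleftrightarrow> D \<subseteq>\<^sub>M P" using powerset by blast
  have "definable (\<lambda>s. is_dense P L (s 0))"
    unfolding is_dense_def by (intro definable_set_intros)
  \<comment> \<open>The family of all dense subsets is a set of the model, by Powerset and
    Separation.\<close>
  from separate[OF this, of Q] obtain \<D>
    where \<D>: "\<forall>D. D \<in>\<^sub>M \<D> \<longleftrightarrow> D \<in>\<^sub>M Q \<and> is_dense P L D" by blast
  then obtain G where G: "is_filter P L G" "is_generic \<D> G"
    using gfp L P semi fin unfolding generic_filter_principle_def by blast
  have "definable (\<lambda>s. \<not> s 0 \<in>\<^sub>M G)" by (intro definable_set_intros)
  from separate[OF this, of P] obtain D where D: "\<forall>p. p \<in>\<^sub>M D \<longleftrightarrow> p \<in>\<^sub>M P \<and> \<not> p \<in>\<^sub>M G"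
    by blast
  have "is_dense P L D"
    unfolding is_dense_def
  proof (intro conjI allI impI)
    show "D \<subseteq>\<^sub>M P" using D by (simp add: subset_of_def)
    fix p assume "p \<in>\<^sub>M P"
    then obtain q r where qr: "q \<in>\<^sub>M P" "r \<in>\<^sub>M P" "rel L q p" "rel L r p" "\<not> compatible P L q r"
      using semi no_min unfolding semi_separative_def by blast
    have "\<not> (q \<in>\<^sub>M G \<and> r \<in>\<^sub>M G)"
      using qr(5) G(1) unfolding is_filter_def compatible_def subset_of_def by blast
    then show "\<exists>q. q \<in>\<^sub>M D \<and> rel L q p" using D qr by blast
  qed
  moreover have "D \<subseteq>\<^sub>M P" using D by (simp add: subset_of_def)
  ultimately have "D \<in>\<^sub>M \<D>" using Q \<D> by simp
  then show False using G(2) D unfolding is_generic_def by blast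
qed

section \<open>The tree of finite paths\<close>

text \<open>The domain \<open>n\<close> is an arbitrary set, so that the same notion covers finite
  paths and, with \<open>\<omega>\<^sub>M\<close> for \<open>n\<close>, infinite ones.\<close>

definition is_path :: "'v \<Rightarrow> 'v \<Rightarrow> 'v \<Rightarrow> 'v \<Rightarrow> bool" where
  "is_path X R n s \<longleftrightarrow>
     is_function s n X \<and> (\<forall>k x y. rel s k x \<and> rel s (suc k) y \<longrightarrow> rel R x y)"

lemma path_extend:
  assumes n: "n \<in>\<^sub>M \<omega>\<^sub>M" and s: "is_path X R n s"
    and X: "nonempty X" "\<forall>x. x \<in>\<^sub>M X \<longrightarrow> (\<exists>y. y \<in>\<^sub>M X \<and> rel R x y)"
  shows "\<exists>x. is_path X R (suc n) (adjoin (pair n x) s)"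
proof -
  have s_fun: "is_function s n X"
    and s_path: "rel s k x \<Longrightarrow> rel s (suc k) y \<Longrightarrow> rel R x y"
    and s_field: "rel s k x \<Longrightarrow> k \<in>\<^sub>M n \<and> x \<in>\<^sub>M X" for k x y
    using s relation_field[of s n X] unfolding is_path_def is_function_def by blast+
  \<comment> \<open>An empty path is prolonged by any member of \<open>X\<close>, a path of length
    \<open>suc k\<close> by an \<open>R\<close>-successor of its value at \<open>k\<close>.\<close>
  obtain x where x: "x \<in>\<^sub>M X" "\<And>k y. n = suc k \<Longrightarrow> rel s k y \<Longrightarrow> rel R y x"
  proof (cases rule: omega_cases[OF n])
    case 1
    have "emp \<noteq> suc k" for k by (metis mem_adjoin not_mem_emp)
    with 1 X(1) that show ?thesis unfolding nonempty_def by blast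
  next
    case (2 k)
    then obtain y where y: "rel s k y"
      using s_fun unfolding is_function_iff by (metis mem_adjoin)
    then obtain x where "x \<in>\<^sub>M X" "rel R y x" using X(2) s_field by blast
    moreover have "z = y" if "rel s k z" for z
      using y s_fun that unfolding is_function_iff by blast
    ultimately show ?thesis using that 2(2) by (metis suc_inject)
  qed
  have "is_function (adjoin (pair n x) s) (suc n) X"
    by (rule is_function_adjoin[OF s_fun]) (use x(1) in \<open>auto simp: subset_of_def\<close>)
  moreover have "rel R y z"
    if yz: "rel (adjoin (pair n x) s) k y" "rel (adjoin (pair n x) s) (suc k) z" for k y z
  proof -
    consider "rel s (suc k) z" | "suc k = n" "z = x" using yz(2) by auto
    then show ?thesis
    proof cases
      case 1
      then have "suc k \<in>\<^sub>M n" using s_field by blast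
      then have "k \<noteq> n" using mem_asym[of "suc k" k] by auto
      with yz(1) have "rel s k y" by simp
      with 1 s_path show ?thesis by blast
    next
      case 2
      then have "k \<noteq> n" using mem_adjoin mem_irrefl by metis
      with yz(1) have "rel s k y" by simp
      with 2 x(2) show ?thesis by blast
    qed
  qed
  ultimately show ?thesis unfolding is_path_def by blast
qed

lemma paths_set:
  "\<exists>T. \<forall>s. s \<in>\<^sub>M T \<longleftrightarrow> (\<exists>n. n \<in>\<^sub>M \<omega>\<^sub>M \<and> is_path X R n s)"
proof -
  have "definable (\<lambda>s. s 0 = s 0 \<and> s (Suc 0) = s (Suc 0))" by (intro definable_set_intros)
  \<comment> \<open>The separating predicate is always true, so \<open>W\<close> is the product of
    \<open>\<omega>\<^sub>M\<close> and \<open>X\<close>. All finite paths are subsets of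
    it.\<close>
  from relation_separate[OF this, of "\<omega>\<^sub>M" X] obtain W
    where W: "\<forall>n x. rel W n x \<longleftrightarrow> n \<in>\<^sub>M \<omega>\<^sub>M \<and> x \<in>\<^sub>M X" by auto
  obtain Q where Q: "\<forall>s. s \<in>\<^sub>M Q \<longleftrightarrow> s \<subseteq>\<^sub>M W" using powerset by blast
  have "definable (\<lambda>s. \<exists>n. n \<in>\<^sub>M \<omega>\<^sub>M \<and> is_path X R n (s 0))"
    unfolding is_path_def by (intro definable_set_intros definable_adjoin)
  from separate[OF this, of Q] obtain T
    where T: "\<forall>s. s \<in>\<^sub>M T \<longleftrightarrow> s \<in>\<^sub>M Q \<and> (\<exists>n. n \<in>\<^sub>M \<omega>\<^sub>M \<and> is_path X R n s)" by blast
  have "s \<in>\<^sub>M Q" if "n \<in>\<^sub>M \<omega>\<^sub>M" "is_path X R n s" for n s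
  proof -
    have s: "is_relation s n X" using that(2) by (simp add: is_path_def is_function_def)
    then have "s \<subseteq>\<^sub>M W"
      by (rule relation_subsetI) (use relation_field[OF s] omega_mem_omega[OF that(1)] W in blast)
    with Q show ?thesis by blast
  qed
  with T show ?thesis by blast
qed

end

section \<open>Chains and infinite branches of the tree, where longer paths are smaller\<close>

locale path_tree = ZF_model +
  fixes X R T L
  assumes X: "nonempty X"
    and R: "\<forall>x. x \<in>\<^sub>M X \<longrightarrow> (\<exists>y. y \<in>\<^sub>M X \<and> rel R x y)"
    and T: "\<forall>s. s \<in>\<^sub>M T \<longleftrightarrow> (\<exists>n. n \<in>\<^sub>M \<omega>\<^sub>M \<and> is_path X R n s)"
    and L_relation: "is_relation L T T"
    and L: "\<forall>s t. rel L s t \<longleftrightarrow> s \<in>\<^sub>M T \<and> t \<in>\<^sub>M T \<and> t \<subseteq>\<^sub>M s"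
begin

lemma tree_order: "is_partial_order T L"
  unfolding is_partial_order_def
proof (intro conjI)
  show "\<forall>p q. rel L p q \<and> rel L q p \<longrightarrow> p = q" using L subset_antisym by blast
qed (use L L_relation in \<open>auto simp: subset_of_def\<close>)

lemma tree_nonempty: "nonempty T"
proof -
  have "is_path X R emp emp"
    by (auto simp: is_path_def is_function_def is_relation_def rel_iff)
  then show ?thesis using T emp_in_omega unfolding nonempty_def by blast
qed

text \<open>A path of length \<open>n\<close> has no value at \<open>n\<close>, so prolonging it
  there gives a different node.\<close>

lemma tree_strict_extension:
  assumes "s \<in>\<^sub>M T"
  shows "\<exists>t. rel L t s \<and> t \<noteq> s"
proof -
  obtain n where n: "n \<in>\<^sub>M \<omega>\<^sub>M" "is_path X R n s" using assms T by blast
  obtain x where x: "is_path X R (suc n) (adjoin (pair n x) s)"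
    using path_extend[OF n X R] by blast
  have "\<not> rel s n x"
    using n(2) relation_field[of s n X n x] mem_irrefl unfolding is_path_def is_function_def by blast
  then have "adjoin (pair n x) s \<noteq> s" by (metis mem_adjoin rel_iff)
  moreover have "adjoin (pair n x) s \<in>\<^sub>M T" using x T n(1) suc_in_omega by blast
  moreover have "s \<subseteq>\<^sub>M adjoin (pair n x) s" by (simp add: subset_of_def)
  ultimately show ?thesis using L assms by blast
qed

lemma tree_functionE:
  assumes "s \<in>\<^sub>M T"
  obtains n where "n \<in>\<^sub>M \<omega>\<^sub>M" "is_function s n X"
  using assms T unfolding is_path_def by blast

text \<open>The tree property: both nodes are restrictions of a common extension to natural numbers,
  and these are comparable by trichotomy.\<close>

lemma compatible_imp_comparable:
  assumes "compatible T L p q"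
  shows "rel L p q \<or> rel L q p"
proof -
  obtain r where r: "p \<in>\<^sub>M T" "q \<in>\<^sub>M T" "r \<in>\<^sub>M T" "p \<subseteq>\<^sub>M r" "q \<subseteq>\<^sub>M r"
    using assms L unfolding compatible_def by blast
  obtain m where m: "m \<in>\<^sub>M \<omega>\<^sub>M" "is_function p m X" using r(1) by (rule tree_functionE)
  obtain n where n: "n \<in>\<^sub>M \<omega>\<^sub>M" "is_function q n X" using r(2) by (rule tree_functionE)
  obtain l where l: "is_function r l X" using r(3) by (rule tree_functionE)
  have "m \<subseteq>\<^sub>M n \<or> n \<subseteq>\<^sub>M m"
    using omega_trichotomy[OF m(1) n(1)] omega_mem_trans[OF m(1)] omega_mem_trans[OF n(1)]
    unfolding subset_of_def by blast
  then have "p \<subseteq>\<^sub>M q \<or> q \<subseteq>\<^sub>M p"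
    using restrictions_subset[OF m(2) n(2) l] restrictions_subset[OF n(2) m(2) l] r by blast
  then show ?thesis using L r by blast
qed

lemma infinite_branch:
  assumes gfp: generic_filter_principle
  shows "\<exists>C. is_linear_subset T L C \<and> \<not> is_finite C"
proof (cases "semi_separative T L")
  case True
  have "\<not> is_minimal T L m" for m
    using tree_strict_extension[of m] L unfolding is_minimal_def by blast
  then show ?thesis
    using generic_filter_principle_imp_minimal[OF gfp tree_order tree_nonempty True] by blast
next
  case False
  \<comment> \<open>Failure of semi-separativity gives a node \<open>p\<close> whose extensions are
    pairwise compatible, hence comparable: its cone is a chain.\<close>
  then obtain p where p: "p \<in>\<^sub>M T" and comp: "\<And>q r. q \<in>\<^sub>M T \<Longrightarrow> r \<in>\<^sub>M T \<Longrightarrow> rel L q p \<Longrightarrow>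
      rel L r p \<Longrightarrow> compatible T L q r"
    unfolding semi_separative_def by blast
  have "definable (\<lambda>s. rel L (s 0) p)" by (intro definable_set_intros)
  from separate[OF this, of T] obtain C where C: "\<forall>q. q \<in>\<^sub>M C \<longleftrightarrow> q \<in>\<^sub>M T \<and> rel L q p" by blast
  have lin: "is_linear_subset T L C"
    using C comp compatible_imp_comparable unfolding is_linear_subset_def subset_of_def by blast
  have "p \<in>\<^sub>M C" using C p tree_order unfolding is_partial_order_def by blast
  then have ne: "nonempty C" unfolding nonempty_def by blast
  \<comment> \<open>The cone has no least element, since a strict extension of \<open>m\<close> is
    again below \<open>p\<close>; so it cannot be finite.\<close>
  have "\<exists>x. x \<in>\<^sub>M C \<and> \<not> rel L m x" if "m \<in>\<^sub>M C" for m
  proof -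
    from that C have m: "m \<in>\<^sub>M T" "rel L m p" by blast+
    then obtain x where x: "rel L x m" "x \<noteq> m" using tree_strict_extension by blast
    then have "x \<in>\<^sub>M C" "\<not> rel L m x"
      using C L m tree_order unfolding is_partial_order_def by blast+
    then show ?thesis by blast
  qed
  then have "\<not> is_finite C" using finite_linear_has_least[OF tree_order lin _ ne] by blast
  with lin show ?thesis by blast
qed

text \<open>Having a value at \<open>n\<close> and none beyond fixes the domain as
  \<open>suc n\<close>, and comparable functions with the same domain are equal.\<close>

lemma same_length_comparable_eq:
  assumes s: "s \<in>\<^sub>M T" "rel s n x" "\<forall>k y. rel s k y \<longrightarrow> k \<in>\<^sub>M suc n"
    and t: "t \<in>\<^sub>M T" "rel t n x'" "\<forall>k y. rel t k y \<longrightarrow> k \<in>\<^sub>M suc n"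
    and st: "rel L s t \<or> rel L t s"
  shows "s = t"
proof -
  have dom: "is_function r (suc n) X"
    if r: "r \<in>\<^sub>M T" "rel r n z" "\<forall>k y. rel r k y \<longrightarrow> k \<in>\<^sub>M suc n" for r z
  proof -
    obtain m where m: "m \<in>\<^sub>M \<omega>\<^sub>M" "is_function r m X" using r(1) by (rule tree_functionE)
    have nm: "n \<in>\<^sub>M m"
      using m(2) r(2) relation_field[of r m X n z] by (simp add: is_function_def)
    \<comment> \<open>The length \<open>m\<close> contains \<open>n\<close> and, being transitive,
      all members of \<open>n\<close>; the bound excludes anything else.\<close>
    have "m = suc n"
    proof (rule set_eqI)
      show "k \<in>\<^sub>M m \<longleftrightarrow> k \<in>\<^sub>M suc n" for k
        using nm omega_mem_trans[OF m(1) nm] r(3) m(2) unfolding is_function_iff mem_adjoin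
        by blast
    qed
    with m(2) show ?thesis by simp
  qed
  have st_fun: "is_function s (suc n) X" "is_function t (suc n) X"
    using dom[OF s] dom[OF t] by blast+
  have refl: "A \<subseteq>\<^sub>M A" for A by (simp add: subset_of_def)
  have "s \<subseteq>\<^sub>M t \<or> t \<subseteq>\<^sub>M s" using st L by blast
  \<comment> \<open>Taking the larger of the two paths as the common extension, equality of the
    domains gives the reverse inclusion.\<close>
  then show ?thesis
    using restrictions_subset[OF st_fun st_fun(2) _ refl refl]
      restrictions_subset[OF st_fun(2,1,1) _ refl refl]
      restrictions_subset[OF st_fun(2,1,2) refl _ refl]
      restrictions_subset[OF st_fun(1,2,1) refl _ refl] subset_antisym by blast
qed

text \<open>Induction on the length bound: a chain bounded by \<open>suc n\<close> has at most one
  path with a value at \<open>n\<close>, and the other paths are bounded by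
  \<open>n\<close>.\<close>

lemma bounded_branch_finite:
  assumes n: "n \<in>\<^sub>M \<omega>\<^sub>M" and "is_linear_subset T L C"
    and "\<forall>s k x. s \<in>\<^sub>M C \<longrightarrow> rel s k x \<longrightarrow> k \<in>\<^sub>M n"
  shows "is_finite C"
proof -
  let ?bdd = "\<lambda>n C. \<forall>s k x. s \<in>\<^sub>M C \<longrightarrow> rel s k x \<longrightarrow> k \<in>\<^sub>M n"
  \<comment> \<open>The chain is quantified inside the induction formula because the step applies
    the hypothesis to a smaller chain.\<close>
  have "\<forall>C. is_linear_subset T L C \<longrightarrow> ?bdd n C \<longrightarrow> is_finite C"
  proof (rule omega_induct[of "\<lambda>n. \<forall>C. is_linear_subset T L C \<longrightarrow> ?bdd n C \<longrightarrow> is_finite C",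
        OF _ _ _ n])
    show "\<forall>C. is_linear_subset T L C \<longrightarrow> ?bdd emp C \<longrightarrow> is_finite C"
    proof (intro allI impI)
      fix C assume lin: "is_linear_subset T L C" and bdd: "?bdd emp C"
      \<comment> \<open>At bound \<open>emp\<close> only the empty path remains, so the chain is
        empty or a singleton.\<close>
      have C: "s = emp" if "s \<in>\<^sub>M C" for s
      proof -
        have "s \<in>\<^sub>M T" using that lin by (simp add: is_linear_subset_def subset_of_def)
        then obtain m where "is_function s m X" by (rule tree_functionE)
        then have "s \<subseteq>\<^sub>M emp"
          using bdd that by (intro relation_subsetI[of s m X]) (auto simp: is_function_def)
        then show ?thesis by (intro set_eqI) (simp add: subset_of_def)
      qed
      show "is_finite C"
      proof (cases "nonempty C")
        case True
        with C have "C = adjoin emp emp"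
          unfolding eq_adjoin_iff nonempty_def by (metis not_mem_emp)
        then show ?thesis by (simp add: finite_adjoin finite_emp)
      next
        case False
        then show ?thesis by (simp add: not_nonempty_iff finite_emp)
      qed
    qed
  next
    fix n assume IH: "\<forall>C. is_linear_subset T L C \<longrightarrow> ?bdd n C \<longrightarrow> is_finite C"
    show "\<forall>C. is_linear_subset T L C \<longrightarrow> ?bdd (suc n) C \<longrightarrow> is_finite C"
    proof (intro allI impI)
      fix C assume lin: "is_linear_subset T L C" and bdd: "?bdd (suc n) C"
      show "is_finite C"
      proof (cases "\<exists>s x. s \<in>\<^sub>M C \<and> rel s n x")
        case False
        then have "?bdd n C" using bdd by (metis mem_adjoin)
        then show ?thesis using IH lin by blast
      next
        case True
        then obtain s x where s: "s \<in>\<^sub>M C" "rel s n x" by blast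
        have unique: "t = s" if t: "t \<in>\<^sub>M C" "rel t n y" for t y
        proof (rule same_length_comparable_eq[OF _ t(2) _ _ s(2)])
          show "t \<in>\<^sub>M T" "s \<in>\<^sub>M T" "rel L t s \<or> rel L s t"
            using lin s(1) t(1) unfolding is_linear_subset_def subset_of_def by blast+
        qed (use bdd s(1) t(1) in blast)+
        have "definable (\<lambda>v. v 0 \<noteq> s)" by (intro definable_set_intros)
        from separate[OF this, of C] obtain D where D: "\<forall>t. t \<in>\<^sub>M D \<longleftrightarrow> t \<in>\<^sub>M C \<and> t \<noteq> s"
          by blast
        then have "is_linear_subset T L D"
          by (intro is_linear_subset_mono[OF lin]) (simp add: subset_of_def)
        moreover have "?bdd n D" using D bdd unique by (metis mem_adjoin)
        ultimately have "is_finite D" using IH by blast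
        moreover have "C = adjoin s D" using D s(1) by (auto simp: eq_adjoin_iff)
        ultimately show ?thesis by (simp add: finite_adjoin)
      qed
    qed
  qed (intro definable_set_intros)
  with assms(2,3) show ?thesis by blast
qed

text \<open>The union of the chain is the path. It is defined at every \<open>n\<close>, as
  otherwise the lengths would be bounded and the chain finite.\<close>

lemma infinite_path_of_infinite_branch:
  assumes lin: "is_linear_subset T L C" and inf: "\<not> is_finite C"
  shows "\<exists>f. is_path X R \<omega>\<^sub>M f"
proof -
  obtain f where f: "\<forall>p. p \<in>\<^sub>M f \<longleftrightarrow> (\<exists>s. p \<in>\<^sub>M s \<and> s \<in>\<^sub>M C)" using union by blast
  have rel_f: "rel f k x \<longleftrightarrow> (\<exists>s. s \<in>\<^sub>M C \<and> rel s k x)" for k x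
    using f by (auto simp: rel_iff)
  have CT: "s \<in>\<^sub>M T" if "s \<in>\<^sub>M C" for s
    using lin that by (simp add: is_linear_subset_def subset_of_def)
  \<comment> \<open>Any two pairs in the union already lie in a single path of the chain. Both
    single-valuedness and the \<open>R\<close>-steps follow from this.\<close>
  have common: "\<exists>s. s \<in>\<^sub>M C \<and> rel s j x \<and> rel s k y" if jk: "rel f j x" "rel f k y" for j k x y
  proof -
    obtain s t where st: "s \<in>\<^sub>M C" "rel s j x" "t \<in>\<^sub>M C" "rel t k y" using jk rel_f by blast
    then have "s \<subseteq>\<^sub>M t \<or> t \<subseteq>\<^sub>M s" using lin L unfolding is_linear_subset_def by blast
    then show ?thesis using st rel_mono by blast
  qed
  have "is_function f \<omega>\<^sub>M X"
    unfolding is_function_iff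
  proof (intro conjI allI impI)
    show "is_relation f \<omega>\<^sub>M X"
      unfolding is_relation_def
    proof (intro allI impI)
      fix p assume "p \<in>\<^sub>M f"
      then obtain s where s: "p \<in>\<^sub>M s" "s \<in>\<^sub>M C" using f by blast
      obtain n where n: "n \<in>\<^sub>M \<omega>\<^sub>M" "is_function s n X" using CT[OF s(2)] by (rule tree_functionE)
      then show "\<exists>x y. x \<in>\<^sub>M \<omega>\<^sub>M \<and> y \<in>\<^sub>M X \<and> is_pair x y p"
        using s(1) omega_mem_omega[OF n(1)] unfolding is_function_def is_relation_def by blast
    qed
    show "\<exists>x. rel f n x" if "n \<in>\<^sub>M \<omega>\<^sub>M" for n
    proof (rule ccontr)
      assume none: "\<nexists>x. rel f n x"
      have "k \<in>\<^sub>M n" if s: "s \<in>\<^sub>M C" "rel s k x" for s k x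
      proof -
        obtain m where m: "m \<in>\<^sub>M \<omega>\<^sub>M" "is_function s m X" using CT[OF s(1)] by (rule tree_functionE)
        have km: "k \<in>\<^sub>M m" using m(2) s(2) relation_field unfolding is_function_def by blast
        have nm: "\<not> n \<in>\<^sub>M m" using m(2) none rel_f s(1) unfolding is_function_iff by blast
        \<comment> \<open>If \<open>f\<close> has no value at \<open>n\<close>, no path in the chain
          does, so \<open>n\<close> is not a member of its length \<open>m\<close>.\<close>
        have "m = n \<or> m \<in>\<^sub>M n" using omega_trichotomy[OF m(1) \<open>n \<in>\<^sub>M \<omega>\<^sub>M\<close>] nm by blast
        then show ?thesis using km omega_mem_trans[OF \<open>n \<in>\<^sub>M \<omega>\<^sub>M\<close>] by blast
      qed
      then show False using bounded_branch_finite[OF that lin] inf by blast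
    qed
    show "x = y" if xy: "rel f n x" "rel f n y" for n x y
    proof -
      obtain s where s: "s \<in>\<^sub>M C" "rel s n x" "rel s n y" using common[OF xy] by blast
      obtain m where "is_function s m X" using CT[OF s(1)] by (rule tree_functionE)
      with s(2,3) show ?thesis unfolding is_function_iff by blast
    qed
  qed
  moreover have "rel R x y" if xy: "rel f k x" "rel f (suc k) y" for k x y
  proof -
    obtain s where s: "s \<in>\<^sub>M C" "rel s k x" "rel s (suc k) y" using common[OF xy] by blast
    then show ?thesis using CT[OF s(1)] T unfolding is_path_def by blast
  qed
  ultimately show ?thesis unfolding is_path_def by blast
qed

end

section \<open>From generic filters to Dependent Choice\<close>

context ZF_model
begin

lemma generic_filter_principle_imp_dependent_choice:
  assumes gfp: generic_filter_principle
  shows dependent_choice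
  unfolding dependent_choice_def
proof (intro allI impI)
  fix X R
  assume XR: "nonempty X \<and> is_relation R X X \<and>
    (\<forall>x. x \<in>\<^sub>M X \<longrightarrow> (\<exists>y. y \<in>\<^sub>M X \<and> rel R x y))"
  obtain T where T: "\<forall>s. s \<in>\<^sub>M T \<longleftrightarrow> (\<exists>n. n \<in>\<^sub>M \<omega>\<^sub>M \<and> is_path X R n s)"
    using paths_set[of X R] by blast
  have "definable (\<lambda>s. s (Suc 0) \<subseteq>\<^sub>M s 0)" by (intro definable_set_intros)
  \<comment> \<open>Reverse inclusion on \<open>T\<close> as a set of pairs: variable
    \<open>0\<close> holds the stronger, longer path.\<close>
  from relation_separate[OF this, of T T] obtain L where L: "is_relation L T T"
    "\<forall>s t. rel L s t \<longleftrightarrow> s \<in>\<^sub>M T \<and> t \<in>\<^sub>M T \<and> t \<subseteq>\<^sub>M s" by blast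
  interpret path_tree mem X R T L
    by unfold_locales (use XR T L in blast)+
  obtain C where "is_linear_subset T L C" "\<not> is_finite C"
    using infinite_branch[OF gfp] by blast
  then obtain f where "is_path X R \<omega>\<^sub>M f" using infinite_path_of_infinite_branch by blast
  then show "\<exists>w f. is_omega w \<and> is_function f w X \<and>
      (\<forall>n m x y. n \<in>\<^sub>M w \<and> is_succ n m \<and> rel f n x \<and> rel f m y \<longrightarrow> rel R x y)"
    unfolding is_path_def is_omega_iff is_succ_iff by blast
qed

end

theorem theorem2p5:
  fixes mem :: "'v \<Rightarrow> 'v \<Rightarrow> bool"
  assumes "ZF_model mem"
  shows "set_structure.dependent_choice mem \<longleftrightarrow> set_structure.generic_filter_principle mem"
proof -
  interpret ZF_model mem by fact
  show ?thesis
    using dependent_choice_imp_generic_filter_principle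
      generic_filter_principle_imp_dependent_choice by blast
qed

end
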